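(* Let $T$ be an invertible tree on $2n$ vertices. If $T$ is isomorphic to its inverse graph $T^{-1}$, then $T$ is (isomorphic to) the rooted product of a tree on $n$ vertices and $n$ copies of rooted $K_2$.
   Context: For a graph $X$, $A(X)$ denotes its adjacency matrix. A tree $T$ is invertible if $A(T)$ is invertible; equivalently, $T$ has a perfect matching, which is then unique. The inverse graph $T^{-1}$ of an invertible tree $T$ is the graph on vertex set $V(T)$ in which distinct vertices $a,b$ are adjacent if and only if $(A(T)^{-1})_{a,b}\neq 0$ (the matrix $A(T)^{-1}$ has zero diagonal and entries in $\{0,\pm1\}$). Rooted product: let $X$ be a graph with vertices $v_1,\ldots,v_n$ and let $Y$ be a disjoint union of rooted graphs $Y_1,\ldots,Y_n$. The rooted product $X(Y)$ is the graph obtained by identifying $v_i$ with the root vertex of $Y_i$ for each $i$. A rooted $K_2$ is $K_2$ with one of its vertices chosen as root. *)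

theory Defs
  imports
    "HOL-Analysis.Analysis"
    "Graph_Theory.Pair_Digraph"
    "Graph_Theory.Digraph_Component"
    "Graph_Theory.Digraph_Isomorphism"
begin

text \<open>
  A finite simple graph is a \<^locale>\<open>pair_graph\<close>: a finite vertex set with a symmetric,
  irreflexive set of arcs, each edge being a pair of opposite arcs. The library constant
  \<^const>\<open>Digraph_Component.tree\<close> is unsuitable for such graphs: it counts the closed walk
  along an edge and back as a cycle. Hence only cycles of length at least 3 are excluded here.
  Connectedness includes non-emptiness.
\<close>

definition undirected_tree :: "'a pair_pre_digraph \<Rightarrow> bool" where
  "undirected_tree T \<longleftrightarrow>
     pair_graph T \<and> Digraph_Component.connected (with_proj T) \<and>
     \<not> (\<exists>p. pre_digraph.cycle (with_proj T) p \<and> 3 \<le> length p)"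

text \<open>
  Rows and columns are indexed by the vertex type, so this is the adjacency matrix of
  \<^term>\<open>X\<close> only when \<^prop>\<open>pverts X = UNIV\<close>.
\<close>

definition adjacency_matrix :: "('a::finite) pair_pre_digraph \<Rightarrow> real ^ 'a ^ 'a" where
  "adjacency_matrix X = (\<chi> a b. if (a, b) \<in> parcs X then 1 else 0)"

definition inverse_graph :: "('a::finite) pair_pre_digraph \<Rightarrow> 'a pair_pre_digraph" where
  "inverse_graph T =
     \<lparr> pverts = pverts T,
       parcs = {(a, b). a \<in> pverts T \<and> b \<in> pverts T \<and> a \<noteq> b \<and>
                  matrix_inv (adjacency_matrix T) $ a $ b \<noteq> 0} \<rparr>"

text \<open>
  A rooted graph is a pair of a graph and its root. The vertices of the rooted product are
  those of the disjoint union of the graphs \<^term>\<open>fst (Y v)\<close>; a vertex \<^term>\<open>v\<close> of \<^term>\<open>X\<close>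
  is identified with the root \<^term>\<open>(v, snd (Y v))\<close> of its copy.
\<close>

type_synonym 'b rooted_graph = "'b pair_pre_digraph \<times> 'b"

definition rooted_product ::
    "'a pair_pre_digraph \<Rightarrow> ('a \<Rightarrow> 'b rooted_graph) \<Rightarrow> ('a \<times> 'b) pair_pre_digraph" where
  "rooted_product X Y =
     \<lparr> pverts = (SIGMA v : pverts X. pverts (fst (Y v))),
       parcs = {((v, y), (v, y')) | v y y'. v \<in> pverts X \<and> (y, y') \<in> parcs (fst (Y v))}
             \<union> {((v, snd (Y v)), (w, snd (Y w))) | v w. (v, w) \<in> parcs X} \<rparr>"

definition rooted_K2 :: "bool rooted_graph" where
  "rooted_K2 = (\<lparr> pverts = UNIV, parcs = {(False, True), (True, False)} \<rparr>, False)"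

end

theory Submission
  imports Defs
begin

text \<open>
  Write \<open>v'\<close> for the partner of \<open>v\<close> in the perfect matching of \<open>T\<close>. By Cramer's rule the entry of
  the inverse adjacency matrix at \<open>(k, j)\<close> is, up to the factor \<open>1 / det A\<close>, a signed count of the
  permutations that send \<open>j\<close> to \<open>k\<close> and every other vertex to a neighbour. A forest admits at most
  one such permutation, because two of them would give a closed walk that never turns back
  (\<open>permutation_along_edges_unique\<close>). Hence the entry is nonzero as soon as one permutation exists
  (\<open>inverse_entry_nonzero\<close>), and rerouting the matching along a path that alternates between
  matching and other edges, starting and ending with a matching edge, produces one.

  Every edge \<open>ab\<close> of \<open>T\<close> yields the edge \<open>a'b'\<close> of the inverse graph: for a matching edge this is the
  edge itself, otherwise it comes from the alternating path \<open>a' a b b'\<close>. This assignment is injective.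
  If \<open>T\<close> is isomorphic to its inverse graph, both have the same number of edges, so these are all the
  edges of the inverse graph. But if neither end of a matching edge \<open>bb'\<close> were a leaf, there would
  be an alternating path \<open>a' a b b' c c'\<close>; the edge \<open>a'c'\<close> that it contributes would have to come from
  an edge \<open>ac\<close>, which closes a square in \<open>T\<close> (\<open>matching_edge_pendant\<close>). Therefore every matching edge
  is a pendant edge. Removing one leaf of each matching edge leaves a tree on half of the vertices,
  and \<open>T\<close> is recovered by attaching a pendant edge at each of its vertices.
\<close>

section \<open>Walks in forests\<close>

text \<open>
  For a finite simple graph this says that the graph is a forest. Quantifying over infinite walks
  makes it easy to apply: going round a closed walk, or following the orbit of a permutation,
  directly provides such a walk, with no need to extract a cycle.
\<close>

definition forces_backtracking :: "'a rel \<Rightarrow> bool" where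
  "forces_backtracking E \<longleftrightarrow>
     (\<forall>w :: nat \<Rightarrow> 'a. (\<forall>i. (w i, w (Suc i)) \<in> E) \<longrightarrow> (\<exists>i. w (Suc (Suc i)) = w i))"

lemma pcas_map_upt:
  "i \<le> j \<Longrightarrow> pcas (w i) (map (\<lambda>k. (w k, w (Suc k))) [i..<j]) (w j)"
proof (induction "j - i" arbitrary: i)
  case (Suc d)
  then have "[i..<j] = i # [Suc i..<j]" by (simp add: upt_conv_Cons)
  with Suc.hyps(1)[of "Suc i"] Suc.hyps(2) show ?case by (simp del: upt_Suc)
qed simp

lemma pawalk_verts_map_upt:
  "i \<le> j \<Longrightarrow> pawalk_verts (w i) (map (\<lambda>k. (w k, w (Suc k))) [i..<j]) = map w [i..<Suc j]"
proof (induction "j - i" arbitrary: i)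
  case (Suc d)
  then have "[i..<j] = i # [Suc i..<j]" "[i..<Suc j] = i # [Suc i..<Suc j]"
    by (simp_all add: upt_conv_Cons)
  with Suc.hyps(1)[of "Suc i"] Suc.hyps(2) show ?case by (simp del: upt_Suc)
qed simp

text \<open>
  A walk revisits some vertex by finiteness. Stop at the first vertex that was visited before:
  the piece between its two visits is a cycle, and if the walk never turns back this cycle has
  length at least 3.
\<close>

lemma undirected_tree_forces_backtracking:
  assumes "undirected_tree T"
  shows "forces_backtracking (parcs T)"
  unfolding forces_backtracking_def
proof (intro allI impI, rule ccontr)
  fix w :: "nat \<Rightarrow> 'a"
  assume walk: "\<forall>i. (w i, w (Suc i)) \<in> parcs T"
    and turn: "\<not> (\<exists>i. w (Suc (Suc i)) = w i)"
  interpret pair_graph T using assms by (simp add: undirected_tree_def)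
  have "range w \<subseteq> pverts T" using walk by (auto dest: in_arcsD1)
  then have "finite (range w)" using pair_finite_verts finite_subset by blast
  then have "\<not> inj w" using finite_imageD infinite_UNIV_nat by blast
  then have ex: "\<exists>j. \<exists>i<j. w i = w j"
    by (auto simp: inj_def) (metis linorder_neqE_nat)
  define j where "j = (LEAST j. \<exists>i<j. w i = w j)"
  from LeastI_ex[OF ex] obtain i where i: "i < j" "w i = w j"
    unfolding j_def by blast
  have first: "w a \<noteq> w b" if "a < b" "b < j" for a b
    using not_less_Least[of b "\<lambda>j. \<exists>i<j. w i = w j"] that unfolding j_def by blast
  \<comment> \<open>A closed piece of length 1 would be a loop, one of length 2 a turn.\<close>
  have "j \<noteq> Suc i" using walk[rule_format, of i] no_loops' i by metis
  moreover have "j \<noteq> Suc (Suc i)" using turn i by metis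
  ultimately have len: "3 \<le> j - i" using i by linarith
  let ?p = "map (\<lambda>k. (w k, w (Suc k))) [i..<j]"
  have "[Suc i..<Suc j] = [Suc i..<j] @ [j]" using i by simp
  moreover have "inj_on w {i..<j}"
    by (rule linorder_inj_onI) (use first in auto)
  then have "inj_on w {Suc i..<j}" by (rule inj_on_subset) auto
  moreover have "w j \<notin> w ` {Suc i..<j}"
    using first[of i] i by (metis Suc_le_eq atLeastLessThan_iff imageE)
  ultimately have "distinct (map w [Suc i..<Suc j])"
    by (simp add: distinct_map)
  moreover have "tl (pawalk_verts (w i) ?p) = map w [Suc i..<Suc j]"
    using pawalk_verts_map_upt[of i j w] i by (simp add: upt_conv_Cons del: upt_Suc)
  moreover have "awalk (w i) ?p (w i)"
    using pcas_map_upt[of i j w] i walk in_arcsD1 by (auto simp: awalk_def)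
  ultimately have "cycle ?p"
    unfolding cycle_def using i by (intro exI[of _ "w i"]) simp
  then show False using assms len by (auto simp: undirected_tree_def)
qed

lemma no_triangle:
  assumes "forces_backtracking E"
    and "(x, y) \<in> E" "(y, z) \<in> E" "(z, x) \<in> E" "x \<noteq> y" "y \<noteq> z" "z \<noteq> x"
  shows False
proof -
  define w where "w n = (if n mod 3 = 0 then x else if n mod 3 = 1 then y else z)" for n :: nat
  have m: "n mod 3 = 0 \<or> n mod 3 = 1 \<or> n mod 3 = 2" for n :: nat by presburger
  have "(w n, w (Suc n)) \<in> E" for n
    using m[of n] assms by (auto simp: w_def mod_Suc)
  moreover have "w (Suc (Suc n)) \<noteq> w n" for n
    using m[of n] assms by (auto simp: w_def mod_Suc)
  ultimately show False using assms(1) unfolding forces_backtracking_def by blast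
qed

lemma no_square:
  assumes "forces_backtracking E"
    and "(x, y) \<in> E" "(y, z) \<in> E" "(z, u) \<in> E" "(u, x) \<in> E" "x \<noteq> z" "y \<noteq> u"
  shows False
proof -
  define w where "w n = (if n mod 4 = 0 then x else if n mod 4 = 1 then y
                         else if n mod 4 = 2 then z else u)" for n :: nat
  have m: "n mod 4 = 0 \<or> n mod 4 = 1 \<or> n mod 4 = 2 \<or> n mod 4 = 3" for n :: nat by presburger
  have "(w n, w (Suc n)) \<in> E" for n
    using m[of n] assms by (auto simp: w_def mod_Suc)
  moreover have "w (Suc (Suc n)) \<noteq> w n" for n
    using m[of n] assms by (auto simp: w_def mod_Suc)
  ultimately show False using assms(1) unfolding forces_backtracking_def by blast
qed

text \<open>
  Stepping forwards along \<open>p\<close> and backwards along \<open>q\<close> from a vertex where they differ traces an orbit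
  of \<open>inv q \<circ> p\<close>. The orbit never reaches a fixed point, so it stays outside \<open>S\<close> and the walk uses
  edges only; it never turns back, because equal vertices two steps apart would also give a fixed
  point.
\<close>

lemma permutation_along_edges_unique:
  assumes "forces_backtracking E" and "sym E"
    and p: "p permutes UNIV" and q: "q permutes UNIV"
    and eq: "\<And>i. i \<in> S \<Longrightarrow> p i = q i"
    and pE: "\<And>i. i \<notin> S \<Longrightarrow> (i, p i) \<in> E" and qE: "\<And>i. i \<notin> S \<Longrightarrow> (i, q i) \<in> E"
  shows "p = q"
proof (rule ccontr)
  assume "p \<noteq> q"
  then obtain v where v: "p v \<noteq> q v" by blast
  define f where "f = inv q \<circ> p"
  have qf: "q (f x) = p x" for x
    using permutes_inverses(1)[OF q] by (simp add: f_def)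
  have f: "f permutes UNIV"
    unfolding f_def using p q by (intro permutes_compose permutes_inv)
  have fS: "f x = x" if "x \<in> S" for x
    using qf[of x] eq[OF that] permutes_inj[OF q] by (metis injD)
  have fv: "f v \<noteq> v" using v qf by metis
  have fixed: "f ((f ^^ k) v) \<noteq> (f ^^ k) v" for k
  proof
    assume "f ((f ^^ k) v) = (f ^^ k) v"
    then have "(f ^^ k) (f v) = (f ^^ k) v" by (simp add: funpow_swap1)
    then show False
      using fv inj_fn[OF permutes_inj[OF f]] by (metis injD)
  qed
  have outside: "(f ^^ k) v \<notin> S" for k using fixed fS by blast
  define w where "w n = (if even n then (f ^^ (n div 2)) v else p ((f ^^ (n div 2)) v))" for n
  have "(w n, w (Suc n)) \<in> E" for n
  proof (cases "even n")
    case True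
    then show ?thesis using pE[OF outside] by (auto simp: w_def)
  next
    case False
    then have "w (Suc n) = f ((f ^^ (n div 2)) v)" by (auto simp: w_def elim!: oddE)
    moreover have "w n = q (f ((f ^^ (n div 2)) v))" using False by (simp add: w_def qf)
    moreover have "f ((f ^^ (n div 2)) v) \<notin> S" using outside[of "Suc (n div 2)"] by simp
    ultimately show ?thesis using qE \<open>sym E\<close> by (auto elim: symE)
  qed
  moreover have "w (Suc (Suc n)) \<noteq> w n" for n
    using fixed[of "n div 2"] injD[OF permutes_inj[OF p]] by (auto simp: w_def)
  ultimately show False using assms(1) unfolding forces_backtracking_def by blast
qed

section \<open>Nonzero entries of the inverse adjacency matrix\<close>

lemma det_nonzero_permutation:
  fixes A :: "'b::comm_ring_1 ^ 'n::finite ^ 'n"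
  assumes "det A \<noteq> 0"
  obtains p where "p permutes UNIV" "\<And>i. A $ i $ p i \<noteq> 0"
proof -
  obtain p where "p permutes (UNIV :: 'n set)" "(\<Prod>i\<in>UNIV. A $ i $ p i) \<noteq> 0"
    using assms unfolding det_def by (force elim: sum.not_neutral_contains_not_neutral)
  moreover from this(2) have "A $ i $ p i \<noteq> 0" for i
    using prod_zero[of UNIV "\<lambda>i. A $ i $ p i"] by auto
  ultimately show thesis using that by blast
qed

text \<open>
  With a single nonzero term in the Leibniz expansion there is no cancellation.
\<close>

lemma det_nonzero_unique_permutation:
  fixes A :: "'b::idom ^ 'n::finite ^ 'n"
  assumes p: "p permutes UNIV" "\<And>i. A $ i $ p i \<noteq> 0"
    and unique: "\<And>q. q permutes UNIV \<Longrightarrow> (\<And>i. A $ i $ q i \<noteq> 0) \<Longrightarrow> q = p"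
  shows "det A \<noteq> 0"
proof -
  have "det A = (\<Sum>q\<in>{p}. of_int (sign q) * (\<Prod>i\<in>UNIV. A $ i $ q i))"
    unfolding det_def
  proof (rule sum.mono_neutral_right)
    show "\<forall>q\<in>{q. q permutes UNIV} - {p}. of_int (sign q) * (\<Prod>i\<in>UNIV. A $ i $ q i) = 0"
      using unique by fastforce
  qed (use p in auto)
  also have "\<dots> \<noteq> 0" using p(2) by (simp add: sign_def)
  finally show ?thesis .
qed

lemma matrix_inv_entry_cramer:
  fixes A :: "real ^ 'n::finite ^ 'n"
  assumes "invertible A"
  shows "matrix_inv A $ k $ j =
    det (\<chi> i l. if l = k then (if i = j then 1 else 0) else A $ i $ l) / det A"
proof -
  have "A ** matrix_inv A = mat 1"
    using assms unfolding invertible_def matrix_inv_def by (rule someI2_ex) simp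
  moreover have "(A *v column j (matrix_inv A)) $ i = (A ** matrix_inv A) $ i $ j" for i
    by (simp add: matrix_vector_mult_def matrix_matrix_mult_def column_def)
  ultimately have "A *v column j (matrix_inv A) = axis j 1"
    by (simp add: vec_eq_iff mat_def axis_def)
  moreover have "det A \<noteq> 0" using assms by (simp add: invertible_det_nz)
  ultimately have "column j (matrix_inv A) =
      (\<chi> k. det (\<chi> i l. if l = k then axis j 1 $ i else A $ i $ l) / det A)"
    by (subst (asm) cramer) auto
  then have "column j (matrix_inv A) $ k =
      det (\<chi> i l. if l = k then axis j 1 $ i else A $ i $ l) / det A"
    by simp
  then show ?thesis by (simp add: column_def axis_def if_distrib cong: if_cong)
qed

text \<open>
  In the matrix of Cramer's rule, column \<open>k\<close> is the unit vector at row \<open>j\<close>. Its nonzero Leibniz terms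
  are therefore the permutations that send \<open>j\<close> to \<open>k\<close> and move along edges elsewhere; in a forest
  there is at most one of them.
\<close>

lemma inverse_entry_nonzero:
  fixes T :: "('a::finite) pair_pre_digraph"
  assumes inv: "invertible (adjacency_matrix T)"
    and E: "forces_backtracking (parcs T)" "sym (parcs T)"
    and p: "p permutes UNIV" "p j = k" "\<And>i. i \<noteq> j \<Longrightarrow> (i, p i) \<in> parcs T"
  shows "matrix_inv (adjacency_matrix T) $ k $ j \<noteq> 0"
proof -
  let ?A = "adjacency_matrix T"
  let ?C = "\<chi> i l. if l = k then (if i = j then 1 else 0) else ?A $ i $ l"
  have "det ?C \<noteq> 0"
  proof (rule det_nonzero_unique_permutation)
    show "p permutes UNIV" by fact
    show "?C $ i $ p i \<noteq> 0" for i
      using p(3)[of i] p(2) injD[OF permutes_inj[OF p(1)], of i j]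
      by (cases "i = j") (auto simp: adjacency_matrix_def)
    fix q assume q: "q permutes UNIV" "\<And>i. ?C $ i $ q i \<noteq> 0"
    obtain i where i: "q i = k" using permutes_surj[OF q(1)] by (metis surjD)
    with q(2)[of i] have qj: "q j = k" by (auto split: if_splits)
    have "(i, q i) \<in> parcs T" if "i \<noteq> j" for i
    proof -
      have "q i \<noteq> k" using qj that injD[OF permutes_inj[OF q(1)]] by metis
      then show ?thesis using q(2)[of i] by (auto simp: adjacency_matrix_def split: if_splits)
    qed
    then show "q = p"
      using p qj by (intro permutation_along_edges_unique[OF E q(1) p(1), of "{j}"]) auto
  qed
  then show ?thesis
    using inv by (simp add: matrix_inv_entry_cramer[OF inv] invertible_det_nz)
qed


text \<open>
  A nonzero Leibniz term of the determinant is a permutation along edges. Its inverse is another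
  one, so uniqueness makes it an involution, that is, a perfect matching.
\<close>

lemma forest_perfect_matching:
  fixes T :: "('a::finite) pair_pre_digraph"
  assumes inv: "invertible (adjacency_matrix T)"
    and E: "forces_backtracking (parcs T)" "sym (parcs T)"
  obtains m where "m permutes UNIV" "\<And>v. (v, m v) \<in> parcs T" "\<And>v. m (m v) = v"
proof -
  obtain m where m: "m permutes UNIV" "\<And>v. adjacency_matrix T $ v $ m v \<noteq> 0"
    using inv det_nonzero_permutation unfolding invertible_det_nz by blast
  have edge: "(v, m v) \<in> parcs T" for v
    using m(2)[of v] by (auto simp: adjacency_matrix_def split: if_splits)
  have "(v, inv m v) \<in> parcs T" for v
    using symD[OF E(2) edge[of "inv m v"]] permutes_inverses(1)[OF m(1)] by simp
  then have "m = inv m"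
    by (intro permutation_along_edges_unique[OF E m(1) permutes_inv[OF m(1)], of "{}"])
      (use edge in auto)
  then have "m (m v) = v" for v
    using permutes_inverses(1)[OF m(1), of v] by metis
  with m(1) edge that show thesis by blast
qed

text \<open>
  This extends an alternating path by two edges. If \<open>p\<close> represents a path from \<open>j\<close> to \<open>p j\<close> and \<open>c\<close>
  is a neighbour of its end, the new permutation represents the path continued through \<open>c\<close> to \<open>p c\<close>,
  the partner of \<open>c\<close> when \<open>c\<close> is not yet on the path.
\<close>

lemma extend_alternating_permutation:
  assumes "p permutes UNIV" "\<And>i. i \<noteq> j \<Longrightarrow> (i, p i) \<in> E"
    and "(c, p j) \<in> E"
  shows "p \<circ> Transposition.transpose j c permutes UNIV"
    and "(p \<circ> Transposition.transpose j c) j = p c"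
    and "\<And>i. i \<noteq> j \<Longrightarrow> (i, (p \<circ> Transposition.transpose j c) i) \<in> E"
  using assms by (auto intro!: permutes_compose permutes_swap_id simp: Transposition.transpose_def)

section \<open>Self-inverse trees\<close>

lemma digraph_iso_card_parcs:
  assumes "digraph_iso (with_proj G) (with_proj H)"
  shows "card (parcs G) = card (parcs H)"
proof -
  obtain f where "pre_digraph.digraph_isomorphism (with_proj G) f"
    and "with_proj H = app_iso f (with_proj G)"
    using assms by (auto simp: digraph_iso_def)
  then have "inj_on (iso_arcs f) (parcs G)" "parcs H = iso_arcs f ` parcs G"
    by (auto simp: pre_digraph.digraph_isomorphism_def app_iso_def with_proj_def)
  then show ?thesis by (simp add: card_image)
qed

text \<open>
  The vertices \<open>a, b, m b, c\<close> would form the middle of an alternating path \<open>m a, a, b, m b, c, m c\<close>.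
  By the isomorphism the inverse graph has no more edges than those coming from the edges of \<open>T\<close>,
  so the edge from \<open>m c\<close> to \<open>m a\<close> that this path contributes forces an edge between \<open>a\<close> and \<open>c\<close>.
\<close>

lemma matching_edge_pendant:
  fixes T :: "('a::finite) pair_pre_digraph"
  assumes V: "pverts T = UNIV"
    and E: "forces_backtracking (parcs T)" "sym (parcs T)" "irrefl (parcs T)"
    and inv: "invertible (adjacency_matrix T)"
    and iso: "digraph_iso (with_proj T) (with_proj (inverse_graph T))"
    and m: "m permutes UNIV" "\<And>v. (v, m v) \<in> parcs T" "\<And>v. m (m v) = v"
    and edges: "(a, b) \<in> parcs T" "(m b, c) \<in> parcs T"
  shows "a = m b \<or> c = b"
proof (rule ccontr)
  assume "\<not> (a = m b \<or> c = b)"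
  then have ne: "a \<noteq> m b" "c \<noteq> b" by auto
  have m_inj: "m x = m y \<longleftrightarrow> x = y" for x y using m(3) by metis
  have E_sym: "(y, x) \<in> parcs T" if "(x, y) \<in> parcs T" for x y using E(2) that by (rule symD)
  have E_irrefl: "x \<noteq> y" if "(x, y) \<in> parcs T" for x y
    using E(3) that by (auto simp: irrefl_def)
  let ?E' = "parcs (inverse_graph T)"
  have in_inverse: "(p j, j) \<in> ?E'"
    if "p permutes UNIV" "\<And>i. i \<noteq> j \<Longrightarrow> (i, p i) \<in> parcs T" "p j \<noteq> j" for p j
    using inverse_entry_nonzero[OF inv E(1,2) that(1) refl that(2)] that(3) V
    by (simp add: inverse_graph_def)
  \<comment> \<open>The permutation of the path \<open>m x, x, y, m y\<close>; it is \<open>m\<close> itself when \<open>y = m x\<close>.\<close>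
  let ?p = "\<lambda>x y. m \<circ> Transposition.transpose (m x) y"
  have p: "?p x y permutes UNIV" "?p x y (m x) = m y"
      "\<And>i. i \<noteq> m x \<Longrightarrow> (i, ?p x y i) \<in> parcs T" if "(x, y) \<in> parcs T" for x y
    using extend_alternating_permutation[of m "m x" "parcs T" y] m E_sym[OF that] by auto

  \<comment> \<open>An equality of cardinalities turns the inclusion of these edges into an equation.\<close>
  define \<phi> where "\<phi> = (\<lambda>(x, y). (m y, m x))"
  have "\<phi> ` parcs T \<subseteq> ?E'"
  proof (clarsimp simp: \<phi>_def)
    fix x y assume xy: "(x, y) \<in> parcs T"
    then have "m y \<noteq> m x" using E_irrefl m_inj by metis
    then show "(m y, m x) \<in> ?E'" using in_inverse[of "?p x y" "m x"] p[OF xy] by simp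
  qed
  moreover have "inj_on \<phi> (parcs T)" by (auto simp: inj_on_def \<phi>_def m_inj)
  then have "card (\<phi> ` parcs T) = card ?E'"
    using digraph_iso_card_parcs[OF iso] by (simp add: card_image)
  ultimately have E'_eq: "?E' = \<phi> ` parcs T"
    by (intro card_subset_eq[symmetric]) auto

  have "c \<noteq> m a"
  proof
    assume "c = m a"
    then show False
      using no_square[OF E(1), of a b "m b" c] edges m E_sym ne by metis
  qed
  have "a \<noteq> c"
    using no_triangle[OF E(1), of a b "m b"] edges m(2)[of b] E_irrefl by metis
  \<comment> \<open>The permutation of the path \<open>m a, a, b, m b, c, m c\<close>.\<close>
  let ?q = "?p a b \<circ> Transposition.transpose (m a) c"
  have pc: "?p a b c = m c" using ne \<open>c \<noteq> m a\<close> by (simp add: Transposition.transpose_def)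
  have "(c, ?p a b (m a)) \<in> parcs T" using p(2)[OF edges(1)] E_sym edges(2) by simp
  from extend_alternating_permutation[OF p(1)[OF edges(1)] p(3)[OF edges(1)] this]
  have "(m c, m a) \<in> ?E'"
    using in_inverse[of ?q "m a"] pc \<open>a \<noteq> c\<close> m_inj by metis
  then have "(a, c) \<in> parcs T" unfolding E'_eq by (auto simp: \<phi>_def m_inj)
  then show False
    using no_square[OF E(1), of a b "m b" c] edges m(2)[of b] E_sym ne by metis
qed

text \<open>
  This picks the roots, \<open>m\<close> being a perfect matching and \<open>P\<close> the property of being a leaf. Where both
  \<open>v\<close> and \<open>m v\<close> satisfy \<open>P\<close>, an arbitrary numbering of the vertices breaks the tie.
\<close>

lemma choose_transversal:
  fixes m :: "'a::finite \<Rightarrow> 'a"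
  assumes "\<And>v. m (m v) = v" "\<And>v. m v \<noteq> v" "\<And>v. P v \<or> P (m v)"
  obtains S where "\<And>v. v \<in> S \<longleftrightarrow> m v \<notin> S" "\<And>v. v \<notin> S \<Longrightarrow> P v"
proof -
  obtain f :: "'a \<Rightarrow> nat" where "inj f"
    using finite_imp_inj_to_nat_seg[of "UNIV :: 'a set"] by auto
  define S where "S = {v. P (m v) \<and> (P v \<longrightarrow> f v < f (m v))}"
  have "f v \<noteq> f (m v)" for v using assms(2) \<open>inj f\<close> by (metis injD)
  then have "v \<in> S \<longleftrightarrow> m v \<notin> S" for v
    using assms(1,3)[of v] unfolding S_def by (auto simp: not_less order.order_iff_strict)
  moreover have "P v" if "v \<notin> S" for v
    using that assms(3)[of v] unfolding S_def by auto
  ultimately show thesis using that by blast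
qed

text \<open>
  Moving each deleted vertex to its only neighbour maps every edge of \<open>T\<close> to an edge or to a single
  vertex of the smaller graph, so connectedness is inherited. Cycles of the smaller graph are
  cycles of \<open>T\<close>.
\<close>

lemma undirected_tree_delete_pendants:
  assumes T: "undirected_tree T"
    and S: "S \<subseteq> pverts T"
    and r: "\<And>v. v \<in> S \<Longrightarrow> r v = v" "\<And>v. v \<in> pverts T \<Longrightarrow> r v \<in> S"
    and pendant: "\<And>v w. (v, w) \<in> parcs T \<Longrightarrow> v \<notin> S \<Longrightarrow> w = r v"
  shows "undirected_tree \<lparr>pverts = S, parcs = parcs T \<inter> S \<times> S\<rparr>" (is "undirected_tree ?X")
proof -
  interpret T: pair_graph T using T by (simp add: undirected_tree_def)
  have graph: "pair_graph ?X"
  proof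
    show "finite (pverts ?X)" using finite_subset[OF S T.pair_finite_verts] by simp
    show "symmetric (with_proj ?X)"
      unfolding symmetric_def by (rule symI) (simp add: T.arcs_symmetric)
    show "finite (parcs ?X)" using T.pair_finite_arcs by simp
    show "fst e \<noteq> snd e" if "e \<in> parcs ?X" for e using T.pair_no_loops that by simp
  qed (use S in auto)
  interpret X: pair_graph ?X by (fact graph)
  have proj: "r v = r w \<or> (r v, r w) \<in> parcs ?X" if "(v, w) \<in> parcs T" for v w
  proof (cases "v \<in> S \<and> w \<in> S")
    case True
    then show ?thesis using r(1) that by simp
  next
    case False
    then show ?thesis
      using pendant[OF that] pendant[OF T.arcs_symmetric[OF that]] r
        T.in_arcsD1[OF that] T.in_arcsD2[OF that] by metis
  qed
  have reach: "r u \<rightarrow>\<^sup>*\<^bsub>with_proj ?X\<^esub> r v" if "u \<rightarrow>\<^sup>*\<^bsub>with_proj T\<^esub> v" for u v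
    using that
  proof (induction rule: T.reachable_induct)
    case base
    then show ?case using r(2) X.reachable_refl by simp
  next
    case (step x y)
    then have "r x = r y \<or> (r x, r y) \<in> parcs ?X" using proj by simp
    then show ?case using step.IH X.reachable_adj_trans[of "r u" "r x" "r y"] by auto
  qed
  have conn_iff: "Digraph_Component.connected (with_proj G) \<longleftrightarrow> strongly_connected (with_proj G)"
    if "pair_graph G" for G :: "'a pair_pre_digraph"
  proof -
    interpret G: pair_graph G by fact
    show ?thesis
      unfolding connected_def strongly_connected_def
      using G.reachable_mk_symmetric_eq[OF G.pair_sym_arcs] by simp
  qed
  have "strongly_connected (with_proj T)"
    using T conn_iff by (auto simp: undirected_tree_def)
  then have "S \<noteq> {}" and "\<And>u v. u \<in> S \<Longrightarrow> v \<in> S \<Longrightarrow> u \<rightarrow>\<^sup>*\<^bsub>with_proj ?X\<^esub> v"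
    using S r reach unfolding strongly_connected_def
    by (simp_all add: subset_iff) (blast, metis)
  then have conn: "Digraph_Component.connected (with_proj ?X)"
    unfolding conn_iff[OF graph] strongly_connected_def by simp
  have "pre_digraph.cycle (with_proj T) p" if "pre_digraph.cycle (with_proj ?X) p" for p
    using that S by (auto simp: T.cycle_def X.cycle_def T.awalk_def X.awalk_def)
  then show ?thesis
    using graph conn T unfolding undirected_tree_def by blast
qed

lemma digraph_iso_with_projI:
  assumes G: "pair_wf_digraph G" and h: "inj_on h (pverts G)"
    and H: "pverts H = h ` pverts G" "parcs H = (\<lambda>(u, v). (h u, h v)) ` parcs G"
  shows "digraph_iso (with_proj G) (with_proj H)"
proof -
  let ?f = "\<lparr>iso_verts = h, iso_arcs = (\<lambda>(u, v). (h u, h v)), iso_head = snd, iso_tail = fst\<rparr>"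
  interpret G: pair_wf_digraph G by fact
  have "parcs G \<subseteq> pverts G \<times> pverts G" using G.in_arcsD1 G.in_arcsD2 by auto
  moreover have "inj_on (\<lambda>(u, v). (h u, h v)) (pverts G \<times> pverts G)"
    using h by (auto simp: inj_on_def)
  ultimately have "inj_on (\<lambda>(u, v). (h u, h v)) (parcs G)"
    by (rule inj_on_subset[rotated])
  then have "pre_digraph.digraph_isomorphism (with_proj G) ?f"
    unfolding pre_digraph.digraph_isomorphism_def wf_digraph_wp_iff
    using G h by (simp add: case_prod_beta)
  moreover have "with_proj H = app_iso ?f (with_proj G)"
    using H by (simp add: app_iso_def with_proj_def)
  ultimately show ?thesis unfolding digraph_iso_def by blast
qed

theorem lemma5p1:
  fixes T :: "('a::finite) pair_pre_digraph" and n :: nat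
  assumes "undirected_tree T"
    and "pverts T = UNIV"
    and "card (pverts T) = 2 * n"
    and "invertible (adjacency_matrix T)"
    and "digraph_iso (with_proj T) (with_proj (inverse_graph T))"
  shows "\<exists>X :: 'a pair_pre_digraph.
           undirected_tree X \<and> card (pverts X) = n \<and>
           digraph_iso (with_proj T) (with_proj (rooted_product X (\<lambda>v. rooted_K2)))"
proof -
  interpret pair_graph T using assms(1) by (simp add: undirected_tree_def)
  have E: "forces_backtracking (parcs T)" "sym (parcs T)" "irrefl (parcs T)"
    using undirected_tree_forces_backtracking[OF assms(1)] pair_sym_arcs no_loops'
    by (auto simp: symmetric_def irrefl_def)
  obtain m where m: "m permutes UNIV" "\<And>v. (v, m v) \<in> parcs T" "\<And>v. m (m v) = v"
    using forest_perfect_matching[OF assms(4) E(1,2)] by blast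
  have m_neq: "m v \<noteq> v" for v using m(2)[of v] no_loops' by metis
  define pendant where "pendant v \<longleftrightarrow> (\<forall>w. (v, w) \<in> parcs T \<longrightarrow> w = m v)" for v
  have "pendant v \<or> pendant (m v)" for v
    using matching_edge_pendant[OF assms(2) E assms(4,5) m] arcs_symmetric m(3)
    unfolding pendant_def by metis
  then obtain S where S: "\<And>v. v \<in> S \<longleftrightarrow> m v \<notin> S" "\<And>v. v \<notin> S \<Longrightarrow> pendant v"
    using choose_transversal[of m pendant] m(3) m_neq by metis
  have mS: "v \<in> S \<Longrightarrow> m v \<notin> S" "v \<notin> S \<Longrightarrow> m v \<in> S" for v
    using S(1)[of v] by blast+
  have leaf: "w = m v" if "(v, w) \<in> parcs T" "v \<notin> S" for v w
    using S(2) that unfolding pendant_def by blast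

  let ?X = "\<lparr>pverts = S, parcs = parcs T \<inter> S \<times> S\<rparr>"
  let ?Y = "rooted_product ?X (\<lambda>v. rooted_K2)"
  have "undirected_tree ?X"
  proof (rule undirected_tree_delete_pendants[OF assms(1)])
    let ?r = "\<lambda>v. if v \<in> S then v else m v"
    show "?r v = v" if "v \<in> S" for v using that by simp
    show "?r v \<in> S" for v using mS by simp
    show "w = ?r v" if "(v, w) \<in> parcs T" "v \<notin> S" for v w using leaf[OF that] that(2) by simp
  qed (use assms(2) in simp_all)
  moreover have "card S = n"
  proof -
    have "m ` S = - S" using mS m(3) by (auto simp: image_iff) metis
    moreover have "card (m ` S) = card S"
      using permutes_inj[OF m(1)] by (intro card_image) (rule inj_on_subset, auto)
    ultimately have "card (UNIV :: 'a set) = card S + card S"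
      using card_Un_disjoint[of S "- S"] by (simp add: Compl_partition)
    then show ?thesis using assms(2,3) by simp
  qed
  moreover have "digraph_iso (with_proj T) (with_proj ?Y)"
  proof (rule digraph_iso_with_projI)
    \<comment> \<open>A vertex of \<open>S\<close> is the root of its copy, its partner is the other vertex of that copy.\<close>
    define h where "h v = (if v \<in> S then (v, False) else (m v, True))" for v
    let ?hh = "\<lambda>(u, v). (h u, h v)"
    have h: "h v = (v, False)" "h (m v) = (v, True)" if "v \<in> S" for v
      using that mS(1) m(3) by (simp_all add: h_def)
    show "pair_wf_digraph T" by unfold_locales
    show "inj_on h (pverts T)"
      using m(3) by (auto simp: h_def intro!: inj_onI split: if_splits) metis
    show "pverts ?Y = h ` pverts T"
    proof
      show "h ` pverts T \<subseteq> pverts ?Y"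
        using mS by (auto simp: rooted_product_def rooted_K2_def h_def)
      have "(v, b) \<in> range h" if "v \<in> S" for v b
        using h[OF that, symmetric] by (cases b) simp_all
      then show "pverts ?Y \<subseteq> h ` pverts T"
        using assms(2) by (auto simp: rooted_product_def rooted_K2_def)
    qed
    show "parcs ?Y = ?hh ` parcs T"
    proof
      show "parcs ?Y \<subseteq> ?hh ` parcs T"
      proof
        fix e assume "e \<in> parcs ?Y"
        then consider v where "v \<in> S" "e = ((v, False), (v, True))"
          | v where "v \<in> S" "e = ((v, True), (v, False))"
          | v w where "(v, w) \<in> parcs T" "v \<in> S" "w \<in> S" "e = ((v, False), (w, False))"
          by (auto simp: rooted_product_def rooted_K2_def)
        then show "e \<in> ?hh ` parcs T"
        proof cases
          case (1 v)
          then have "e = ?hh (v, m v)" using h by simp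
          then show ?thesis using m(2) by (rule image_eqI)
        next
          case (2 v)
          then have "e = ?hh (m v, v)" using h by simp
          then show ?thesis using arcs_symmetric[OF m(2)] by (rule image_eqI)
        next
          case (3 v w)
          then have "e = ?hh (v, w)" using h by simp
          then show ?thesis using 3(1) by (rule image_eqI)
        qed
      qed
      have "(h v, h w) \<in> parcs ?Y" if vw: "(v, w) \<in> parcs T" for v w
      proof -
        consider "v \<in> S" "w \<in> S" | "v \<notin> S" "w = m v" | "w \<notin> S" "v = m w"
          using leaf[OF vw] leaf[OF arcs_symmetric[OF vw]] by blast
        then show ?thesis
        proof cases
          case 1
          then show ?thesis using vw h by (auto simp: rooted_product_def rooted_K2_def)
        next
          case 2
          then show ?thesis using mS m(3) h[of "m v"] by (auto simp: rooted_product_def rooted_K2_def)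
        next
          case 3
          then show ?thesis using mS m(3) h[of "m w"] by (auto simp: rooted_product_def rooted_K2_def)
        qed
      qed
      then show "?hh ` parcs T \<subseteq> parcs ?Y" by auto
    qed
  qed
  ultimately show ?thesis by (intro exI[of _ ?X]) simp
qed

end
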